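(* Let $R$ be a dually compact domain (DCD). Then $R$ is a $v$-G-Dedekind domain if and only if $R$ is a $\ast$-domain.
   Context: $R$ is an integral domain with quotient field $K$, $F(R)$ is the set of nonzero fractional ideals of $R$, and $(a)=aR$ for $a\in K$. For $A\in F(R)$, $A^{-1}=\{x\in K: xA\subseteq R\}$ and $A_v=(A^{-1})^{-1}$. $R$ is dually compact (a DCD) if for every nonempty set $\{a_\alpha\}_{\alpha\in I}\subseteq K\setminus\{0\}$ with $\bigcap_{\alpha\in I}(a_\alpha)\neq(0)$ there is a finite set $\{x_1,\dots,x_n\}\subseteq K\setminus\{0\}$ with $\bigcap_{\alpha\in I}(a_\alpha)=\bigcap_{i=1}^n(x_i)$. $R$ is a $v$-G-Dedekind domain (also called G-Dedekind or Pseudo Dedekind) if $A_v$ is invertible for each $A\in F(R)$. $R$ is a $\ast$-domain if for all pairs of finite nonempty subsets $\{a_1,\dots,a_m\},\{b_1,\dots,b_n\}\subseteq K\setminus\{0\}$ we have $\left(\bigcap_{i=1}^m(a_i)\right)\left(\bigcap_{j=1}^n(b_j)\right)=\bigcap_{i,j}(a_ib_j)$ (here $\ast$ is just the name of this property, not a star operation). *)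

theory Defs
  imports "HOL-Computational_Algebra.Polynomial_Factorial"
begin

text \<open>
  The domain \<open>R\<close> is a type \<open>'a :: idom\<close>, its quotient field \<open>K\<close> is the type \<open>'a fract\<close>, and
  \<open>range to_fract\<close> is \<open>R\<close> as a subset of \<open>K\<close>.  Properties of the domain itself take an argument
  of type \<open>'a itself\<close>.  The interpretation below makes \<open>K\<close> an \<open>R\<close>-module, so that
  \<open>R_module.subspace\<close> is the notion of \<open>R\<close>-submodule of \<open>K\<close> and \<open>R_module.span\<close> the submodule
  generated by a set.
\<close>

interpretation R_module: module "\<lambda>(r :: 'a :: idom) (x :: 'a fract). to_fract r * x"
  by unfold_locales (simp_all add: algebra_simps)

definition fractional_ideals :: "'a :: idom fract set set" where
  "fractional_ideals =
     {A. R_module.subspace A \<and> A \<noteq> {0} \<and>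
         (\<exists>d. d \<noteq> 0 \<and> (\<forall>x\<in>A. to_fract d * x \<in> range to_fract))}"

definition principal :: "'a :: idom fract \<Rightarrow> 'a fract set" where
  "principal a = {a * to_fract r | r. True}"

definition ideal_times :: "'a :: idom fract set \<Rightarrow> 'a fract set \<Rightarrow> 'a fract set" where
  "ideal_times A B = R_module.span {a * b | a b. a \<in> A \<and> b \<in> B}"

definition ideal_inv :: "'a :: idom fract set \<Rightarrow> 'a fract set" where
  "ideal_inv A = {x. \<forall>a\<in>A. x * a \<in> range to_fract}"

definition v_closure :: "'a :: idom fract set \<Rightarrow> 'a fract set" where
  "v_closure A = ideal_inv (ideal_inv A)"

definition invertible_ideal :: "'a :: idom fract set \<Rightarrow> bool" where
  "invertible_ideal A \<longleftrightarrow>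
     A \<in> fractional_ideals \<and> (\<exists>B\<in>fractional_ideals. ideal_times A B = range to_fract)"

text \<open>
  Families of generators are represented by their sets of values; the intersections below depend
  on nothing else.
\<close>

definition dually_compact :: "'a :: idom itself \<Rightarrow> bool" where
  "dually_compact _ \<longleftrightarrow>
     (\<forall>S :: 'a fract set. S \<noteq> {} \<and> 0 \<notin> S \<and> (\<Inter>a\<in>S. principal a) \<noteq> {0} \<longrightarrow>
        (\<exists>X. finite X \<and> X \<noteq> {} \<and> 0 \<notin> X \<and> (\<Inter>a\<in>S. principal a) = (\<Inter>x\<in>X. principal x)))"

definition v_G_Dedekind :: "'a :: idom itself \<Rightarrow> bool" where
  "v_G_Dedekind _ \<longleftrightarrow>
     (\<forall>A \<in> (fractional_ideals :: 'a fract set set). invertible_ideal (v_closure A))"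

definition ast_domain :: "'a :: idom itself \<Rightarrow> bool" where
  "ast_domain _ \<longleftrightarrow>
     (\<forall>S T :: 'a fract set.
        finite S \<and> S \<noteq> {} \<and> 0 \<notin> S \<and> finite T \<and> T \<noteq> {} \<and> 0 \<notin> T \<longrightarrow>
          ideal_times (\<Inter>a\<in>S. principal a) (\<Inter>b\<in>T. principal b) =
            (\<Inter>a\<in>S. \<Inter>b\<in>T. principal (a * b)))"

end

theory Submission
  imports Defs
begin

text \<open>
  Every \<open>A\<inverse>\<close> is the intersection of the principal ideals \<open>(1/a)\<close> with \<open>0 \<noteq> a \<in> A\<close>, so dual
  compactness gives \<open>A\<inverse> = \<Inter>(x\<^sub>i)\<close> and \<open>A\<^sub>v = \<Inter>(y\<^sub>j)\<close> with finitely many \<open>x\<^sub>i\<close> and \<open>y\<^sub>j\<close>.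
  In a \<open>\<ast>\<close>-domain \<open>A\<inverse> A\<^sub>v = \<Inter>(x\<^sub>i y\<^sub>j)\<close>; since \<open>1/y\<^sub>j \<in> (A\<^sub>v)\<inverse> = A\<inverse> \<subseteq> (x\<^sub>i)\<close>, this
  contains \<open>1\<close>, so \<open>A\<^sub>v\<close> is invertible.  Conversely, let \<open>I = \<Inter>(a\<^sub>i)\<close> and \<open>J = \<Inter>(b\<^sub>j)\<close>.  Then
  \<open>J = J\<^sub>v\<close> is invertible in a \<open>v\<close>-G-Dedekind domain, say \<open>J J' = R\<close>.  If \<open>z \<in> \<Inter>(a\<^sub>i b\<^sub>j)\<close>, then
  \<open>z/a\<^sub>i \<in> J\<close> for all \<open>i\<close>, hence \<open>z J' \<subseteq> I\<close> and \<open>z \<in> z J J' \<subseteq> I J\<close>.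
\<close>

section \<open>Submodules of the quotient field and products of ideals\<close>

lemma mem_principal_iff:
  assumes "a \<noteq> 0"
  shows "x \<in> principal a \<longleftrightarrow> x / a \<in> range to_fract"
  using assms by (auto simp: principal_def field_simps)

lemma to_fract_mult_in_range:
  "x \<in> range to_fract \<Longrightarrow> y \<in> range to_fract \<Longrightarrow> x * y \<in> range to_fract"
  by (auto simp flip: to_fract_mult)

lemma subspace_range_to_fract: "R_module.subspace (range to_fract)"
  by (rule R_module.subspaceI)
     (use range_eqI[of 0 to_fract 0] in \<open>auto simp flip: to_fract_add to_fract_mult\<close>)

lemma subspace_principal: "R_module.subspace (principal a)"
proof (rule R_module.subspaceI)
  show "0 \<in> principal a"
    by (auto simp: principal_def intro: exI[of _ 0])
next
  fix x y assume "x \<in> principal a" "y \<in> principal a"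
  then obtain r s where "x = a * to_fract r" "y = a * to_fract s"
    by (auto simp: principal_def)
  then have "x + y = a * to_fract (r + s)"
    by (simp add: algebra_simps)
  then show "x + y \<in> principal a"
    unfolding principal_def by blast
next
  fix c x assume "x \<in> principal a"
  then obtain r where "x = a * to_fract r"
    by (auto simp: principal_def)
  then have "to_fract c * x = a * to_fract (c * r)"
    by (simp add: algebra_simps)
  then show "to_fract c * x \<in> principal a"
    unfolding principal_def by blast
qed

text \<open>Multiplication by \<open>z\<close> is linear. This allows an inclusion of the form
  \<open>z\<close> times a product of ideals in \<open>C\<close> to be tested on products of
  elements.\<close>

lemma subspace_mult_vimage:
  assumes "R_module.subspace C"
  shows "R_module.subspace {w. z * w \<in> C}"
proof (rule R_module.subspaceI)
  fix c x assume "x \<in> {w. z * w \<in> C}"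
  then have "to_fract c * (z * x) \<in> C"
    using R_module.subspace_scale[OF assms] by blast
  then show "to_fract c * x \<in> {w. z * w \<in> C}"
    by (simp add: mult.left_commute)
qed (use assms in \<open>auto simp: distrib_left R_module.subspace_0 R_module.subspace_add\<close>)

lemma subspace_INT_principal: "R_module.subspace (\<Inter>a\<in>S. principal a)"
  by (rule R_module.subspace_Inter) (auto simp: subspace_principal)

text \<open>Universal property of the span: a submodule contains the product as soon as it contains
  the generators.\<close>

lemma ideal_times_subset_iff:
  assumes "R_module.subspace C"
  shows "ideal_times A B \<subseteq> C \<longleftrightarrow> (\<forall>a\<in>A. \<forall>b\<in>B. a * b \<in> C)"
proof
  assume sub: "ideal_times A B \<subseteq> C"
  have "{a * b | a b. a \<in> A \<and> b \<in> B} \<subseteq> ideal_times A B"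
    unfolding ideal_times_def by (rule R_module.span_superset)
  then show "\<forall>a\<in>A. \<forall>b\<in>B. a * b \<in> C"
    using sub by blast
next
  assume "\<forall>a\<in>A. \<forall>b\<in>B. a * b \<in> C"
  then show "ideal_times A B \<subseteq> C"
    unfolding ideal_times_def using assms by (intro R_module.span_minimal) auto
qed

lemma subspace_ideal_times: "R_module.subspace (ideal_times A B)"
  unfolding ideal_times_def by (rule R_module.subspace_span)

lemma mult_in_ideal_times: "a \<in> A \<Longrightarrow> b \<in> B \<Longrightarrow> a * b \<in> ideal_times A B"
  using ideal_times_subset_iff[OF subspace_ideal_times, of A B] by blast

section \<open>Inverses, fractional ideals and v-closures\<close>

lemma ideal_inv_eq_INT:
  fixes A :: "'a :: idom fract set"
  shows "ideal_inv A = (\<Inter>a\<in>inverse ` (A - {0}). principal a)"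
proof -
  have "(0 :: 'a fract) \<in> range to_fract"
    by (rule R_module.subspace_0[OF subspace_range_to_fract])
  then have "x * a \<in> range to_fract \<longleftrightarrow> a = 0 \<or> x \<in> principal (inverse a)" for x a :: "'a fract"
    by (cases "a = 0") (simp_all add: mem_principal_iff divide_inverse)
  then show ?thesis
    unfolding ideal_inv_def by auto
qed

lemma fractional_ideal_nonzero_elem:
  assumes "A \<in> fractional_ideals"
  obtains a where "a \<in> A" "a \<noteq> 0"
  using assms R_module.subspace_0 unfolding fractional_ideals_def by blast

lemma fract_denominator:
  obtains d where "d \<noteq> 0" "to_fract d * (x :: 'a :: idom fract) \<in> range to_fract"
proof (cases x)
  case (Fract n d)
  then have "to_fract d * x = to_fract n"
    by (simp add: to_fract_def eq_fract)
  then show ?thesis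
    using that Fract by blast
qed

lemma INT_principal_fractional_ideal:
  assumes "S \<noteq> {}" "0 \<notin> S" "(\<Inter>a\<in>S. principal a) \<noteq> {0}"
  shows "(\<Inter>a\<in>S. principal a) \<in> fractional_ideals"
proof -
  obtain a where a: "a \<in> S" "a \<noteq> 0"
    using assms by blast
  obtain d where d: "d \<noteq> 0" "to_fract d * a \<in> range to_fract"
    by (rule fract_denominator)
  \<comment> \<open>A denominator of one generator \<open>a\<close> clears all of
    \<open>principal a\<close>, hence the whole intersection.\<close>
  have "to_fract d * x \<in> range to_fract" if "x \<in> principal a" for x
  proof -
    from that obtain r where "x = a * to_fract r"
      by (auto simp: principal_def)
    then show ?thesis
      using to_fract_mult_in_range[OF d(2), of "to_fract r"] by (simp add: mult.assoc)
  qed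
  then show ?thesis
    using a d assms subspace_INT_principal[of S] unfolding fractional_ideals_def by blast
qed

lemma ideal_inv_nonzero:
  assumes "A \<in> fractional_ideals"
  shows "ideal_inv A \<noteq> {0}"
proof -
  obtain d where "d \<noteq> 0" "\<forall>x\<in>A. to_fract d * x \<in> range to_fract"
    using assms by (auto simp: fractional_ideals_def)
  \<comment> \<open>A common denominator of \<open>A\<close> is itself a nonzero element of the
    inverse.\<close>
  then have "to_fract d \<in> ideal_inv A" "to_fract d \<noteq> 0"
    by (auto simp: ideal_inv_def)
  then show ?thesis by blast
qed

lemma ideal_inv_fractional_ideal:
  assumes "A \<in> fractional_ideals"
  shows "ideal_inv A \<in> fractional_ideals"
proof -
  obtain a where "a \<in> A" "a \<noteq> 0"
    using assms by (rule fractional_ideal_nonzero_elem)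
  then show ?thesis
    using ideal_inv_nonzero[OF assms] unfolding ideal_inv_eq_INT
    by (intro INT_principal_fractional_ideal) auto
qed

lemma subset_v_closure: "A \<subseteq> v_closure A"
  by (auto simp: v_closure_def ideal_inv_def mult.commute)

lemma ideal_inv_v_closure: "ideal_inv (v_closure A) = ideal_inv A"
proof
  show "ideal_inv (v_closure A) \<subseteq> ideal_inv A"
    using subset_v_closure[of A] by (auto simp: ideal_inv_def)
  \<comment> \<open>Both \<open>ideal_inv (v_closure A)\<close> and
    \<open>v_closure (ideal_inv A)\<close> are the threefold inverse of \<open>A\<close>.\<close>
  show "ideal_inv A \<subseteq> ideal_inv (v_closure A)"
    using subset_v_closure[of "ideal_inv A"] by (simp add: v_closure_def)
qed

text \<open>Each \<open>inverse a\<close> with \<open>a\<close> in \<open>S\<close> multiplies the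
  intersection into the domain, so it must also multiply the v-closure into the domain. Together
  with \<open>subset_v_closure\<close> this makes such intersections divisorial.\<close>

lemma v_closure_INT_principal_subset:
  assumes "0 \<notin> S"
  shows "v_closure (\<Inter>a\<in>S. principal a) \<subseteq> (\<Inter>a\<in>S. principal a)"
proof
  fix x assume x: "x \<in> v_closure (\<Inter>a\<in>S. principal a)"
  show "x \<in> (\<Inter>a\<in>S. principal a)"
  proof
    fix a assume a: "a \<in> S"
    with assms have "a \<noteq> 0" by auto
    with a have "inverse a \<in> ideal_inv (\<Inter>a\<in>S. principal a)"
      by (auto simp: ideal_inv_def mem_principal_iff field_simps)
    with x have "x * inverse a \<in> range to_fract"
      unfolding v_closure_def ideal_inv_def[of "ideal_inv _"] by blast
    with \<open>a \<noteq> 0\<close> show "x \<in> principal a"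
      by (simp add: mem_principal_iff divide_inverse)
  qed
qed

text \<open>Serves to show that a finite intersection of nonzero principal ideals is
  nonzero.\<close>

lemma finite_common_multiple:
  fixes S :: "'a :: idom fract set"
  assumes "finite S" "0 \<notin> S"
  shows "\<exists>c. c \<noteq> 0 \<and> (\<forall>a\<in>S. to_fract c \<in> principal a)"
  using assms
proof (induction S rule: finite_induct)
  case empty
  show ?case by (auto intro: exI[of _ 1])
next
  case (insert s S)
  then obtain c where c: "c \<noteq> 0" "\<forall>a\<in>S. to_fract c \<in> principal a"
    by auto
  \<comment> \<open>A denominator of \<open>inverse s\<close> is a multiple of \<open>s\<close>; the
    product \<open>c * d\<close> then works for \<open>insert s S\<close>.\<close>
  obtain d where d: "d \<noteq> 0" "to_fract d * inverse s \<in> range to_fract"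
    by (rule fract_denominator)
  have "to_fract d \<in> principal s"
    using d insert.prems by (simp add: mem_principal_iff divide_inverse)
  then have "to_fract (c * d) \<in> principal a" if "a \<in> insert s S" for a
    using that c(2) R_module.subspace_scale[OF subspace_principal, of "to_fract c" a d]
      R_module.subspace_scale[OF subspace_principal, of "to_fract d" s c]
    by (auto simp: mult.commute)
  then show ?case
    using c(1) d(1) by (intro exI[of _ "c * d"]) auto
qed

lemma finite_INT_principal_fractional_ideal:
  assumes "finite S" "S \<noteq> {}" "0 \<notin> S"
  shows "(\<Inter>a\<in>S. principal a) \<in> fractional_ideals"
proof (rule INT_principal_fractional_ideal)
  obtain c where "c \<noteq> 0" "\<forall>a\<in>S. to_fract c \<in> principal a"
    using finite_common_multiple assms by blast
  then have "to_fract c \<in> (\<Inter>a\<in>S. principal a)" "to_fract c \<noteq> 0"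
    by auto
  then show "(\<Inter>a\<in>S. principal a) \<noteq> {0}" by blast
qed (use assms in auto)

section \<open>The product formula from invertibility of divisorial ideals\<close>

lemma v_G_Dedekind_imp_ast_domain:
  assumes "v_G_Dedekind TYPE('a :: idom)"
  shows "ast_domain TYPE('a)"
  unfolding ast_domain_def
proof (intro allI impI, elim conjE)
  fix S T :: "'a fract set"
  assume S: "finite S" "S \<noteq> {}" "0 \<notin> S" and T: "finite T" "T \<noteq> {}" "0 \<notin> T"
  define I J where "I = (\<Inter>a\<in>S. principal a)" and "J = (\<Inter>b\<in>T. principal b)"
  have J: "J \<in> fractional_ideals"
    unfolding J_def using T by (rule finite_INT_principal_fractional_ideal)
  have "v_closure J = J"
    using v_closure_INT_principal_subset[OF T(3)] subset_v_closure unfolding J_def by blast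
  with assms J have "invertible_ideal J"
    by (metis v_G_Dedekind_def)
  then obtain J' where J': "ideal_times J J' = range to_fract"
    by (auto simp: invertible_ideal_def)
  have "ideal_times I J \<subseteq> (\<Inter>a\<in>S. \<Inter>b\<in>T. principal (a * b))"
  proof (subst ideal_times_subset_iff)
    show "R_module.subspace (\<Inter>a\<in>S. \<Inter>b\<in>T. principal (a * b))"
      by (intro R_module.subspace_Inter ballI)
         (auto intro!: R_module.subspace_Inter simp: subspace_principal)
    show "\<forall>x\<in>I. \<forall>y\<in>J. x * y \<in> (\<Inter>a\<in>S. \<Inter>b\<in>T. principal (a * b))"
    proof (intro ballI INT_I)
      fix x y a b assume *: "x \<in> I" "y \<in> J" "a \<in> S" "b \<in> T"
      then have "x \<in> principal a" "y \<in> principal b" "a \<noteq> 0" "b \<noteq> 0"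
        using S T by (auto simp: I_def J_def)
      then show "x * y \<in> principal (a * b)"
        using to_fract_mult_in_range[of "x / a" "y / b"] by (simp add: mem_principal_iff)
    qed
  qed
  moreover have "z \<in> ideal_times I J" if z: "z \<in> (\<Inter>a\<in>S. \<Inter>b\<in>T. principal (a * b))" for z
  proof -
    have mult_I: "z * w \<in> I" if w: "w \<in> J'" for w
      unfolding I_def
    proof
      fix a assume a: "a \<in> S"
      with S have "a \<noteq> 0" by auto
      have "z / a \<in> principal b" if b: "b \<in> T" for b
      proof -
        have "b \<noteq> 0" using b T by auto
        have "z \<in> principal (a * b)"
          using z a b by blast
        then show ?thesis
          using \<open>a \<noteq> 0\<close> \<open>b \<noteq> 0\<close> by (simp add: mem_principal_iff)
      qed
      then have "z / a \<in> J"
        by (auto simp: J_def)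
      then have "z / a * w \<in> range to_fract"
        using mult_in_ideal_times[of "z / a" J w J'] w J' by auto
      then show "z * w \<in> principal a"
        using \<open>a \<noteq> 0\<close> by (simp add: mem_principal_iff)
    qed
    \<comment> \<open>The elements that \<open>z\<close> multiplies into
      \<open>ideal_times I J\<close> form a submodule, so products \<open>x * w\<close> suffice.
      Since 1 lies in \<open>ideal_times J J'\<close>, this puts \<open>z\<close> itself into
      \<open>ideal_times I J\<close>.\<close>
    have "ideal_times J J' \<subseteq> {w. z * w \<in> ideal_times I J}"
    proof (subst ideal_times_subset_iff[OF subspace_mult_vimage[OF subspace_ideal_times]], intro ballI)
      fix x w assume "x \<in> J" "w \<in> J'"
      then have "(z * w) * x \<in> ideal_times I J"
        by (intro mult_in_ideal_times mult_I)
      then show "x * w \<in> {w. z * w \<in> ideal_times I J}"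
        by (simp add: mult_ac)
    qed
    moreover have "1 \<in> ideal_times J J'"
      using J' to_fract_1 by (metis rangeI)
    ultimately show ?thesis by auto
  qed
  ultimately show "ideal_times (\<Inter>a\<in>S. principal a) (\<Inter>b\<in>T. principal b) =
      (\<Inter>a\<in>S. \<Inter>b\<in>T. principal (a * b))"
    unfolding I_def J_def by blast
qed

section \<open>Invertibility of v-closures under dual compactness\<close>

lemma dually_compact_ideal_inv:
  fixes A :: "'a :: idom fract set"
  assumes "dually_compact TYPE('a)" "A \<in> fractional_ideals"
  obtains X where "finite X" "X \<noteq> {}" "0 \<notin> X" "ideal_inv A = (\<Inter>x\<in>X. principal x)"
proof -
  obtain a where "a \<in> A" "a \<noteq> 0"
    using assms(2) by (rule fractional_ideal_nonzero_elem)
  \<comment> \<open>The element \<open>a\<close> makes the family nonempty, and a common denominator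
    of \<open>A\<close> makes its intersection nonzero, as dual compactness demands.\<close>
  then have "inverse ` (A - {0}) \<noteq> {} \<and> 0 \<notin> inverse ` (A - {0}) \<and>
      (\<Inter>a\<in>inverse ` (A - {0}). principal a) \<noteq> {0}"
    using ideal_inv_nonzero[OF assms(2)] unfolding ideal_inv_eq_INT by auto
  then have "\<exists>X. finite X \<and> X \<noteq> {} \<and> 0 \<notin> X \<and> ideal_inv A = (\<Inter>x\<in>X. principal x)"
    using assms(1)[unfolded dually_compact_def, rule_format] unfolding ideal_inv_eq_INT by meson
  then show ?thesis
    using that by blast
qed

lemma ast_domain_imp_v_G_Dedekind:
  assumes dc: "dually_compact TYPE('a :: idom)" and ast: "ast_domain TYPE('a)"
  shows "v_G_Dedekind TYPE('a)"
  unfolding v_G_Dedekind_def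
proof
  fix A :: "'a fract set"
  assume A: "A \<in> fractional_ideals"
  have B: "ideal_inv A \<in> fractional_ideals" and C: "v_closure A \<in> fractional_ideals"
    using A by (simp_all add: v_closure_def ideal_inv_fractional_ideal)
  obtain X where X: "finite X" "X \<noteq> {}" "0 \<notin> X" "ideal_inv A = (\<Inter>x\<in>X. principal x)"
    using dc A by (rule dually_compact_ideal_inv)
  \<comment> \<open>Dual compactness is now applied to \<open>ideal_inv A\<close>, whose inverse is
    \<open>v_closure A\<close>.\<close>
  obtain Y where Y: "finite Y" "Y \<noteq> {}" "0 \<notin> Y" "v_closure A = (\<Inter>y\<in>Y. principal y)"
    using dc B unfolding v_closure_def by (rule dually_compact_ideal_inv)
  let ?P = "ideal_times (v_closure A) (ideal_inv A)"
  have P: "?P = (\<Inter>y\<in>Y. \<Inter>x\<in>X. principal (y * x))"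
    using ast X Y by (simp add: ast_domain_def)
  have "?P \<subseteq> range to_fract"
    unfolding ideal_times_subset_iff[OF subspace_range_to_fract]
    by (simp add: v_closure_def ideal_inv_def[of "ideal_inv A"])
  moreover have "1 \<in> ?P"
    unfolding P
  proof (intro INT_I)
    fix y x assume xy: "y \<in> Y" "x \<in> X"
    then have "x \<noteq> 0" "y \<noteq> 0" using X Y by auto
    \<comment> \<open>\<open>v_closure A\<close> lies in \<open>principal y\<close>, so division by
      \<open>y\<close> sends it into the domain.\<close>
    have "inverse y \<in> ideal_inv (v_closure A)"
      using xy \<open>y \<noteq> 0\<close> unfolding Y(4) by (auto simp: ideal_inv_def mem_principal_iff field_simps)
    then have "inverse y \<in> principal x"
      using xy X by (auto simp: ideal_inv_v_closure)
    then show "1 \<in> principal (y * x)"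
      using \<open>x \<noteq> 0\<close> \<open>y \<noteq> 0\<close> by (simp add: mem_principal_iff divide_simps)
  qed
  \<comment> \<open>A submodule containing 1 contains every scalar multiple of it.\<close>
  then have "range to_fract \<subseteq> ?P"
    using R_module.subspace_scale[OF subspace_ideal_times, of 1] by fastforce
  ultimately have "?P = range to_fract" by blast
  with B C show "invertible_ideal (v_closure A)"
    unfolding invertible_ideal_def by blast
qed

theorem theorem3p3:
  assumes "dually_compact TYPE('a :: idom)"
  shows "v_G_Dedekind TYPE('a) \<longleftrightarrow> ast_domain TYPE('a)"
  using assms v_G_Dedekind_imp_ast_domain ast_domain_imp_v_G_Dedekind by blast

end
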